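(* Let $m,n>0$ be real numbers, let $I\subseteq\mathbb{R}$ be an interval and let $\gamma:I\to(\mathrm{Sol}^3_{m,n},g)$, $\gamma(s)=(x(s),y(s),t(s))$, be a smooth curve, where $g=e^{-2mt}dx^2+e^{2nt}dy^2+dt^2$. Then $\gamma$ is a geodesic if and only if its coordinate functions satisfy on $I$ the system $$\begin{cases}x''-2m\,t'x'=0,\\ y''+2n\,t'y'=0,\\ t''+m\,e^{-2mt}(x')^2-n\,e^{2nt}(y')^2=0,\end{cases}$$ where primes denote derivatives with respect to $s$.
   Context: For real $m,n>0$, $\mathrm{Sol}^3_{m,n}$ is the semidirect product $\mathbb{R}^2\rtimes_U\mathbb{R}$ with $U(t)=\mathrm{diag}(e^{mt},e^{-nt})$; its underlying manifold is $\mathbb{R}^3$ with global coordinates $(x,y,t)$. It carries the left-invariant Riemannian metric $g=e^{-2mt}dx^2+e^{2nt}dy^2+dt^2$. A curve $\gamma$ is a geodesic if the covariant derivative of $\gamma'$ along $\gamma$ (Levi-Civita connection of $g$) vanishes. *)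

theory Defs
  imports "HOL-Analysis.Analysis"
begin

text \<open>
  Derivatives are taken within \<open>S\<close>, so the same notion serves for the whole space and for
  an interval, where it is one-sided at an endpoint belonging to the interval. It is meaningful only
  for sets in which derivatives within \<open>S\<close> are unique, such as \<open>UNIV\<close> and the intervals
  that are not a single point.
\<close>

primrec times_diff_on ::
  "nat \<Rightarrow> 'a::real_normed_vector set \<Rightarrow> ('a \<Rightarrow> 'b::real_normed_vector) \<Rightarrow> bool" where
  "times_diff_on 0 S f \<longleftrightarrow> continuous_on S f"
| "times_diff_on (Suc k) S f \<longleftrightarrow> f differentiable_on S \<and>
     (\<forall>v. times_diff_on k S (\<lambda>p. frechet_derivative f (at p within S) v))"

definition smooth_on :: "'a::real_normed_vector set \<Rightarrow> ('a \<Rightarrow> 'b::real_normed_vector) \<Rightarrow> bool" where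
  "smooth_on S f \<longleftrightarrow> (\<forall>k. times_diff_on k S f)"

definition derivative_in :: "real set \<Rightarrow> (real \<Rightarrow> 'b::real_normed_vector) \<Rightarrow> real \<Rightarrow> 'b" where
  "derivative_in I f = (\<lambda>s. vector_derivative f (at s within I))"

text \<open>
  The manifolds considered have a single global chart: the underlying manifold is a Euclidean space
  \<open>'a\<close>, every tangent space is identified with \<open>'a\<close> through the coordinate frame, a
  vector field is a function \<open>'a \<Rightarrow> 'a\<close>, and \<open>g p u v\<close> is the metric at
  \<open>p\<close> applied to the tangent vectors \<open>u\<close> and \<open>v\<close>.
\<close>

type_synonym 'a vfield = "'a \<Rightarrow> 'a"

type_synonym 'a metric_tensor = "'a \<Rightarrow> 'a \<Rightarrow> 'a \<Rightarrow> real"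

definition dir_deriv ::
  "'a::euclidean_space vfield \<Rightarrow> ('a \<Rightarrow> 'b::real_normed_vector) \<Rightarrow> 'a \<Rightarrow> 'b" where
  "dir_deriv X f p = frechet_derivative f (at p) (X p)"

definition lie_bracket :: "'a::euclidean_space vfield \<Rightarrow> 'a vfield \<Rightarrow> 'a vfield" where
  "lie_bracket X Y p = dir_deriv X Y p - dir_deriv Y X p"

text \<open>Only the values of \<open>nabla\<close> on smooth vector fields are relevant.\<close>

definition affine_connection ::
  "('a::euclidean_space vfield \<Rightarrow> 'a vfield \<Rightarrow> 'a vfield) \<Rightarrow> bool" where
  "affine_connection nabla \<longleftrightarrow>
     (\<forall>X Y. smooth_on UNIV X \<longrightarrow> smooth_on UNIV Y \<longrightarrow> smooth_on UNIV (nabla X Y)) \<and>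
     (\<forall>(f::'a \<Rightarrow> real) (h::'a \<Rightarrow> real) X Z Y.
        smooth_on UNIV f \<longrightarrow> smooth_on UNIV h \<longrightarrow>
        smooth_on UNIV X \<longrightarrow> smooth_on UNIV Z \<longrightarrow> smooth_on UNIV Y \<longrightarrow>
        nabla (\<lambda>p. f p *\<^sub>R X p + h p *\<^sub>R Z p) Y = (\<lambda>p. f p *\<^sub>R nabla X Y p + h p *\<^sub>R nabla Z Y p)) \<and>
     (\<forall>(a::real) (b::real) X Y Z.
        smooth_on UNIV X \<longrightarrow> smooth_on UNIV Y \<longrightarrow> smooth_on UNIV Z \<longrightarrow>
        nabla X (\<lambda>p. a *\<^sub>R Y p + b *\<^sub>R Z p) = (\<lambda>p. a *\<^sub>R nabla X Y p + b *\<^sub>R nabla X Z p)) \<and>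
     (\<forall>(f::'a \<Rightarrow> real) X Y.
        smooth_on UNIV f \<longrightarrow> smooth_on UNIV X \<longrightarrow> smooth_on UNIV Y \<longrightarrow>
        nabla X (\<lambda>p. f p *\<^sub>R Y p) = (\<lambda>p. dir_deriv X f p *\<^sub>R Y p + f p *\<^sub>R nabla X Y p))"

definition torsion_free ::
  "('a::euclidean_space vfield \<Rightarrow> 'a vfield \<Rightarrow> 'a vfield) \<Rightarrow> bool" where
  "torsion_free nabla \<longleftrightarrow>
     (\<forall>X Y. smooth_on UNIV X \<longrightarrow> smooth_on UNIV Y \<longrightarrow>
        (\<forall>p. nabla X Y p - nabla Y X p = lie_bracket X Y p))"

definition metric_compatible ::
  "'a::euclidean_space metric_tensor \<Rightarrow> ('a vfield \<Rightarrow> 'a vfield \<Rightarrow> 'a vfield) \<Rightarrow> bool" where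
  "metric_compatible g nabla \<longleftrightarrow>
     (\<forall>X Y Z. smooth_on UNIV X \<longrightarrow> smooth_on UNIV Y \<longrightarrow> smooth_on UNIV Z \<longrightarrow>
        (\<forall>p. dir_deriv Z (\<lambda>q. g q (X q) (Y q)) p = g p (nabla Z X p) (Y p) + g p (X p) (nabla Z Y p)))"

definition levi_civita ::
  "'a::euclidean_space metric_tensor \<Rightarrow> ('a vfield \<Rightarrow> 'a vfield \<Rightarrow> 'a vfield) \<Rightarrow> bool" where
  "levi_civita g nabla \<longleftrightarrow>
     affine_connection nabla \<and> torsion_free nabla \<and> metric_compatible g nabla"

text \<open>
  A vector field along \<open>\<gamma>\<close> is a function \<open>V :: real \<Rightarrow> 'a\<close> with \<open>V s\<close> tangent at
  \<open>\<gamma> s\<close>. In the last condition the field \<open>W\<close> extends the single vector \<open>\<gamma>' s\<close>; since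
  \<open>nabla\<close> is function-linear in its first argument, the right-hand side is
  \<open>\<nabla>\<close> applied to \<open>\<gamma>' s\<close> and \<open>X\<close> and does not depend on the extension.
\<close>

definition covariant_derivative_along ::
  "('a::euclidean_space vfield \<Rightarrow> 'a vfield \<Rightarrow> 'a vfield) \<Rightarrow> real set \<Rightarrow> (real \<Rightarrow> 'a) \<Rightarrow>
   ((real \<Rightarrow> 'a) \<Rightarrow> real \<Rightarrow> 'a) \<Rightarrow> bool" where
  "covariant_derivative_along nabla I \<gamma> D \<longleftrightarrow>
     (\<forall>V. smooth_on I V \<longrightarrow> smooth_on I (D V)) \<and>
     (\<forall>(a::real) (b::real) V W. smooth_on I V \<longrightarrow> smooth_on I W \<longrightarrow>
        (\<forall>s\<in>I. D (\<lambda>r. a *\<^sub>R V r + b *\<^sub>R W r) s = a *\<^sub>R D V s + b *\<^sub>R D W s)) \<and>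
     (\<forall>(f::real \<Rightarrow> real) V. smooth_on I f \<longrightarrow> smooth_on I V \<longrightarrow>
        (\<forall>s\<in>I. D (\<lambda>r. f r *\<^sub>R V r) s = derivative_in I f s *\<^sub>R V s + f s *\<^sub>R D V s)) \<and>
     (\<forall>X W. smooth_on UNIV X \<longrightarrow> smooth_on UNIV W \<longrightarrow>
        (\<forall>s\<in>I. W (\<gamma> s) = derivative_in I \<gamma> s \<longrightarrow> D (\<lambda>r. X (\<gamma> r)) s = nabla W X (\<gamma> s)))"

text \<open>
  For a Riemannian metric and a smooth curve on an interval that is not a single point, \<open>nabla\<close> is
  unique on smooth fields, and so are the values on \<open>I\<close> that \<open>D\<close> assigns to smooth fields.
\<close>

definition geodesic_on ::
  "'a::euclidean_space metric_tensor \<Rightarrow> real set \<Rightarrow> (real \<Rightarrow> 'a) \<Rightarrow> bool" where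
  "geodesic_on g I \<gamma> \<longleftrightarrow>
     (\<exists>nabla D. levi_civita g nabla \<and> covariant_derivative_along nabla I \<gamma> D \<and>
        (\<forall>s\<in>I. D (derivative_in I \<gamma>) s = 0))"

text \<open>In \<open>real ^ 3\<close> the components 1, 2, 3 are the coordinates \<open>x, y, t\<close>.\<close>

definition sol_metric :: "real \<Rightarrow> real \<Rightarrow> (real ^ 3) metric_tensor" where
  "sol_metric m n p u v =
     exp (- 2 * m * p $ 3) * u $ 1 * v $ 1 + exp (2 * n * p $ 3) * u $ 2 * v $ 2 + u $ 3 * v $ 3"

end

theory Submission
  imports Defs
begin

text \<open>
  In the coordinate frame the Levi-Civita connection is the flat connection plus a bilinear
  Christoffel term \<open>\<Gamma>\<close>. Koszul's formula on constant fields determines \<open>\<Gamma>\<close>, and linearity together with the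
  Leibniz rule then forces \<open>D V = V' + \<Gamma>(\<gamma>', V)\<close> for every covariant derivative along \<open>\<gamma>\<close>.
  Conversely, the connection and the derivative defined by these formulas have the required
  properties. So being a geodesic means \<open>\<gamma>'' + \<Gamma>(\<gamma>', \<gamma>') = 0\<close>, whose components are the system.
\<close>

section \<open>Smooth functions on sets with unique derivatives\<close>

text \<open>This is the approach condition under which
  \<open>frechet_derivative_unique_within\<close> applies: along each basis direction,
  \<open>S\<close> has points arbitrarily close to \<open>p\<close>. For an endpoint of an interval,
  one sign of \<open>d\<close> is enough.\<close>

definition unique_derivs :: "'a::euclidean_space set \<Rightarrow> bool" where
  "unique_derivs S \<longleftrightarrow>
     (\<forall>p\<in>S. \<forall>i\<in>Basis. \<forall>e>0. \<exists>d. 0 < \<bar>d\<bar> \<and> \<bar>d\<bar> < e \<and> p + d *\<^sub>R i \<in> S)"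

lemma unique_derivs_UNIV: "unique_derivs UNIV"
  unfolding unique_derivs_def
proof (intro ballI allI impI)
  fix e :: real assume "e > 0"
  then show "\<exists>d. 0 < \<bar>d\<bar> \<and> \<bar>d\<bar> < e \<and> p + d *\<^sub>R i \<in> UNIV" for p i :: 'a
    by (intro exI[of _ "e / 2"]) auto
qed

text \<open>A nonempty interval that is not a single point has, besides \<open>p\<close>, another
  point \<open>q\<close>, and the segment from \<open>p\<close> to \<open>q\<close> supplies the
  small steps.\<close>

lemma unique_derivs_interval:
  fixes I :: "real set"
  assumes "is_interval I" and "\<And>a. I \<noteq> {a}"
  shows "unique_derivs I"
  unfolding unique_derivs_def
proof (intro ballI allI impI)
  fix p i e :: real
  assume p: "p \<in> I" and i: "i \<in> Basis" and e: "e > 0"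
  from assms(2)[of p] p obtain q where q: "q \<in> I" "q \<noteq> p" by blast
  \<comment> \<open>The step goes from \<open>p\<close> towards \<open>q\<close>; the bound by the
    distance keeps it on the segment, and \<open>e / 2\<close> makes it strictly shorter than
    \<open>e\<close>.\<close>
  define d where "d = sgn (q - p) * min (e / 2) \<bar>q - p\<bar>"
  have d: "0 < \<bar>d\<bar>" "\<bar>d\<bar> < e"
    using q e by (auto simp: d_def abs_mult sgn_if min_def)
  have "p \<le> p + d \<and> p + d \<le> q \<or> q \<le> p + d \<and> p + d \<le> p"
    using q e by (auto simp: d_def sgn_if min_def)
  then have "p + d \<in> I"
    using assms(1) p q unfolding is_interval_1 by blast
  then show "\<exists>d. 0 < \<bar>d\<bar> \<and> \<bar>d\<bar> < e \<and> p + d *\<^sub>R i \<in> I"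
    using d i by auto
qed

section \<open>Derivatives within a set: uniqueness and dependence on values in the set\<close>

lemma frechet_derivative_within_eq:
  assumes "unique_derivs S" "p \<in> S" "(f has_derivative f') (at p within S)"
  shows "frechet_derivative f (at p within S) = f'"
proof -
  have "(f has_derivative frechet_derivative f (at p within S)) (at p within S)"
    using assms(3) frechet_derivative_works differentiable_def by blast
  then show ?thesis
    using frechet_derivative_unique_within[OF _ assms(3)] assms(1,2)
    unfolding unique_derivs_def by blast
qed

lemma has_derivative_within_cong:
  assumes "p \<in> S" "\<And>q. q \<in> S \<Longrightarrow> f q = g q"
  shows "(f has_derivative f') (at p within S) \<longleftrightarrow> (g has_derivative f') (at p within S)"
  using has_derivative_transform[OF assms(1), of f g] has_derivative_transform[OF assms(1), of g f]
    assms(2) by metis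

text \<open>\<open>frechet_derivative\<close> is a choice from the predicate
  \<open>has_derivative\<close>; equal predicates give equal choices, also where no derivative
  exists.\<close>

lemma frechet_derivative_within_cong:
  assumes "p \<in> S" "\<And>q. q \<in> S \<Longrightarrow> f q = g q"
  shows "frechet_derivative f (at p within S) = frechet_derivative g (at p within S)"
  by (simp add: frechet_derivative_def has_derivative_within_cong[OF assms])

lemma times_diff_on_cong:
  assumes "\<And>q. q \<in> S \<Longrightarrow> f q = g q"
  shows "times_diff_on k S f \<longleftrightarrow> times_diff_on k S g"
  using assms
proof (induction k arbitrary: f g)
  case 0
  then show ?case by (auto intro: continuous_on_cong)
next
  case (Suc k)
  have "f differentiable_on S \<longleftrightarrow> g differentiable_on S"
    by (simp add: differentiable_on_def differentiable_def
        has_derivative_within_cong[OF _ Suc.prems])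
  moreover have "times_diff_on k S (\<lambda>p. frechet_derivative f (at p within S) v) \<longleftrightarrow>
      times_diff_on k S (\<lambda>p. frechet_derivative g (at p within S) v)" for v
    by (rule Suc.IH) (simp add: frechet_derivative_within_cong[OF _ Suc.prems])
  ultimately show ?case by simp
qed

lemma smooth_on_cong:
  "(\<And>q. q \<in> S \<Longrightarrow> f q = g q) \<Longrightarrow> smooth_on S f \<longleftrightarrow> smooth_on S g"
  unfolding smooth_on_def using times_diff_on_cong by blast

lemma times_diff_on_Suc_D: "times_diff_on (Suc k) S f \<Longrightarrow> times_diff_on k S f"
proof (induction k arbitrary: f)
  case 0
  then show ?case by (simp add: differentiable_imp_continuous_on)
next
  case (Suc k)
  then show ?case by (metis times_diff_on.simps(2))
qed

text \<open>Uniqueness lets an explicit formula \<open>f'\<close> replace the chosen derivative on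
  \<open>S\<close>. The inductive closure proofs below go through this rule.\<close>

lemma times_diff_on_SucI:
  assumes "unique_derivs S"
    and "\<And>p. p \<in> S \<Longrightarrow> (f has_derivative f' p) (at p within S)"
    and "\<And>v. times_diff_on k S (\<lambda>p. f' p v)"
  shows "times_diff_on (Suc k) S f"
proof -
  have "times_diff_on k S (\<lambda>p. frechet_derivative f (at p within S) v)" for v
    by (subst times_diff_on_cong[where g = "\<lambda>p. f' p v"])
       (simp_all add: frechet_derivative_within_eq[OF assms(1) _ assms(2)] assms(3))
  moreover have "f differentiable_on S"
    using assms(2) unfolding differentiable_on_def differentiable_def by blast
  ultimately show ?thesis by simp
qed

lemma times_diff_on_Suc_has_derivative:
  assumes "times_diff_on (Suc k) S f" "p \<in> S"
  shows "(f has_derivative frechet_derivative f (at p within S)) (at p within S)"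
  using assms by (simp add: differentiable_on_def frechet_derivative_works)

lemma smooth_on_has_derivative:
  assumes "smooth_on S f" "p \<in> S"
  shows "(f has_derivative frechet_derivative f (at p within S)) (at p within S)"
  using assms unfolding smooth_on_def by (blast intro: times_diff_on_Suc_has_derivative)

lemma smooth_on_frechet_derivative:
  "smooth_on S f \<Longrightarrow> smooth_on S (\<lambda>p. frechet_derivative f (at p within S) v)"
  unfolding smooth_on_def by (metis times_diff_on.simps(2))

section \<open>Closure properties of smooth functions\<close>

lemma times_diff_on_const: "unique_derivs S \<Longrightarrow> times_diff_on k S (\<lambda>_. c)"
proof (induction k arbitrary: c)
  case (Suc k)
  then show ?case by (intro times_diff_on_SucI[where f' = "\<lambda>_ _. 0"]) auto
qed simp

lemma smooth_on_const: "unique_derivs S \<Longrightarrow> smooth_on S (\<lambda>_. c)"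
  by (simp add: smooth_on_def times_diff_on_const)

lemma smooth_on_ident:
  assumes "unique_derivs S"
  shows "smooth_on S (\<lambda>p. p)"
  unfolding smooth_on_def
proof
  fix k
  show "times_diff_on k S (\<lambda>p. p)"
  proof (cases k)
    case (Suc j)
    then show ?thesis
      using times_diff_on_SucI[OF assms, of "\<lambda>p. p" "\<lambda>_ v. v"]
      by (simp add: times_diff_on_const[OF assms] del: times_diff_on.simps)
  qed simp
qed

lemma times_diff_on_add:
  "unique_derivs S \<Longrightarrow> times_diff_on k S f \<Longrightarrow> times_diff_on k S g \<Longrightarrow>
    times_diff_on k S (\<lambda>p. f p + g p)"
proof (induction k arbitrary: f g)
  case 0
  then show ?case by (simp add: continuous_on_add)
next
  case (Suc k)
  show ?case
  proof (rule times_diff_on_SucI[OF Suc.prems(1)])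
    fix p assume "p \<in> S"
    then show "((\<lambda>p. f p + g p) has_derivative
        (\<lambda>v. frechet_derivative f (at p within S) v + frechet_derivative g (at p within S) v))
        (at p within S)"
      using Suc.prems times_diff_on_Suc_has_derivative has_derivative_add by blast
  qed (use Suc in simp)
qed

lemma smooth_on_add:
  "unique_derivs S \<Longrightarrow> smooth_on S f \<Longrightarrow> smooth_on S g \<Longrightarrow> smooth_on S (\<lambda>p. f p + g p)"
  by (simp add: smooth_on_def times_diff_on_add)

text \<open>By the product rule the derivative is a sum of two terms of the form \<open>B\<close>
  applied to functions of order \<open>k\<close>, so the induction hypothesis covers it when
  \<open>f\<close> and \<open>g\<close> are arbitrary.\<close>

lemma times_diff_on_bilinear:
  assumes "bounded_bilinear B" "unique_derivs S"
  shows "times_diff_on k S f \<Longrightarrow> times_diff_on k S g \<Longrightarrow> times_diff_on k S (\<lambda>p. B (f p) (g p))"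
proof (induction k arbitrary: f g)
  case 0
  then show ?case using bounded_bilinear.continuous_on[OF assms(1)] by simp
next
  case (Suc k)
  show ?case
  proof (rule times_diff_on_SucI[OF assms(2)])
    fix p assume "p \<in> S"
    then show "((\<lambda>p. B (f p) (g p)) has_derivative
        (\<lambda>v. B (f p) (frechet_derivative g (at p within S) v) +
             B (frechet_derivative f (at p within S) v) (g p))) (at p within S)"
      by (intro bounded_bilinear.FDERIV[OF assms(1)]
          times_diff_on_Suc_has_derivative[OF Suc.prems(1)]
          times_diff_on_Suc_has_derivative[OF Suc.prems(2)])
  next
    \<comment> \<open>The product rule contains \<open>f\<close> and \<open>g\<close> themselves, so
      their order is lowered to that of their derivatives.\<close>
    have *: "times_diff_on k S f" "times_diff_on k S g"
      using Suc.prems times_diff_on_Suc_D by blast+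
    show "times_diff_on k S (\<lambda>p. B (f p) (frechet_derivative g (at p within S) v) +
        B (frechet_derivative f (at p within S) v) (g p))" for v
      using Suc.prems by (intro times_diff_on_add[OF assms(2)] Suc.IH *) simp_all
  qed
qed

lemma smooth_on_bilinear:
  assumes "bounded_bilinear B" "unique_derivs S" "smooth_on S f" "smooth_on S g"
  shows "smooth_on S (\<lambda>p. B (f p) (g p))"
  using assms by (simp add: smooth_on_def times_diff_on_bilinear)

lemmas smooth_on_mult = smooth_on_bilinear[OF bounded_bilinear_mult]
  and smooth_on_scaleR = smooth_on_bilinear[OF bounded_bilinear_scaleR]
  and smooth_on_inner = smooth_on_bilinear[OF bounded_bilinear_inner]

text \<open>The derivative \<open>exp (f p) * f'\<close> contains the same exponential again, now
  needed only to order \<open>k\<close>, so the induction runs with \<open>f\<close> fixed.\<close>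

lemma times_diff_on_exp:
  fixes f :: "'a::euclidean_space \<Rightarrow> real"
  assumes "unique_derivs S"
  shows "times_diff_on k S f \<Longrightarrow> times_diff_on k S (\<lambda>p. exp (f p))"
proof (induction k)
  case 0
  then show ?case by (simp add: continuous_on_exp)
next
  case (Suc k)
  show ?case
  proof (rule times_diff_on_SucI[OF assms])
    fix p assume "p \<in> S"
    show "((\<lambda>p. exp (f p)) has_derivative
        (\<lambda>v. exp (f p) * frechet_derivative f (at p within S) v)) (at p within S)"
      by (rule derivative_eq_intros times_diff_on_Suc_has_derivative[OF Suc.prems \<open>p \<in> S\<close>])+
         (simp add: mult.commute)
  next
    show "times_diff_on k S (\<lambda>p. exp (f p) * frechet_derivative f (at p within S) v)" for v
      using Suc.prems
      by (intro times_diff_on_bilinear[OF bounded_bilinear_mult assms] Suc.IH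
          times_diff_on_Suc_D[OF Suc.prems]) simp_all
  qed
qed

lemma smooth_on_exp:
  fixes f :: "'a::euclidean_space \<Rightarrow> real"
  shows "unique_derivs S \<Longrightarrow> smooth_on S f \<Longrightarrow> smooth_on S (\<lambda>p. exp (f p))"
  by (simp add: smooth_on_def times_diff_on_exp)

lemma smooth_on_sum:
  assumes "unique_derivs S" "\<And>i. i \<in> A \<Longrightarrow> smooth_on S (f i)"
  shows "smooth_on S (\<lambda>p. \<Sum>i\<in>A. f i p)"
  using assms(2)
  by (induction A rule: infinite_finite_induct)
     (simp_all add: smooth_on_const smooth_on_add assms(1))

lemma smooth_on_vec_nth:
  fixes f :: "'a::euclidean_space \<Rightarrow> real ^ 'n"
  assumes "unique_derivs S" "smooth_on S f"
  shows "smooth_on S (\<lambda>p. f p $ i)"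
  using smooth_on_inner[OF assms smooth_on_const[OF assms(1), of "axis i 1"]]
  by (simp add: inner_axis)

lemma vector_3_eq: "(vector [a, b, c] :: real ^ 3) = a *\<^sub>R axis 1 1 + b *\<^sub>R axis 2 1 + c *\<^sub>R axis 3 1"
  by (simp add: vec_eq_iff forall_3 axis_def)

lemma smooth_on_vector_3:
  fixes a b c :: "'a::euclidean_space \<Rightarrow> real"
  assumes "unique_derivs S" "smooth_on S a" "smooth_on S b" "smooth_on S c"
  shows "smooth_on S (\<lambda>p. vector [a p, b p, c p] :: real ^ 3)"
  unfolding vector_3_eq using assms
  by (intro smooth_on_add smooth_on_scaleR smooth_on_const)

text \<open>Smoothness of \<open>Y\<close> controls its derivative in a fixed direction only.
  Expanding the varying direction \<open>X p\<close> in the basis gives a finite sum of smooth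
  coefficients times such derivatives.\<close>

lemma smooth_on_dir_deriv:
  fixes Y :: "'a::euclidean_space \<Rightarrow> 'b::real_normed_vector"
  assumes "smooth_on UNIV X" "smooth_on UNIV Y"
  shows "smooth_on UNIV (dir_deriv X Y)"
proof -
  have "dir_deriv X Y = (\<lambda>p. \<Sum>b\<in>Basis. (X p \<bullet> b) *\<^sub>R frechet_derivative Y (at p) b)"
  proof
    fix p
    interpret linear "frechet_derivative Y (at p)"
      using smooth_on_has_derivative[OF assms(2)] has_derivative_linear by blast
    have "dir_deriv X Y p = frechet_derivative Y (at p) (\<Sum>b\<in>Basis. (X p \<bullet> b) *\<^sub>R b)"
      by (simp add: dir_deriv_def euclidean_representation)
    then show "dir_deriv X Y p = (\<Sum>b\<in>Basis. (X p \<bullet> b) *\<^sub>R frechet_derivative Y (at p) b)"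
      by (simp add: sum scaleR)
  qed
  then show ?thesis
    using assms by (simp add: smooth_on_sum smooth_on_scaleR smooth_on_inner smooth_on_const
        smooth_on_frechet_derivative unique_derivs_UNIV)
qed

lemma dir_deriv_eq: "(f has_derivative f') (at p) \<Longrightarrow> dir_deriv X f p = f' (X p)"
  unfolding dir_deriv_def using frechet_derivative_at by metis

section \<open>Derivatives of curves within their parameter set\<close>

lemma has_vector_derivative_in:
  assumes "smooth_on I f" "s \<in> I"
  shows "(f has_vector_derivative derivative_in I f s) (at s within I)"
  unfolding derivative_in_def using smooth_on_has_derivative[OF assms]
  by (metis differentiableI vector_derivative_works)

lemma derivative_in_eq_frechet:
  assumes "unique_derivs I" "smooth_on I f" "s \<in> I"
  shows "derivative_in I f s = frechet_derivative f (at s within I) 1"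
  using frechet_derivative_within_eq[OF assms(1,3)] has_vector_derivative_in[OF assms(2,3)]
  unfolding has_vector_derivative_def by fastforce

lemma derivative_in_eq:
  assumes "unique_derivs I" "s \<in> I" "(f has_vector_derivative f') (at s within I)"
  shows "derivative_in I f s = f'"
proof -
  have "(f has_vector_derivative derivative_in I f s) (at s within I)"
    unfolding derivative_in_def using assms(3)
    by (metis differentiableI_vector vector_derivative_works)
  then show ?thesis
    using assms(3) frechet_derivative_within_eq[OF assms(1,2)]
    unfolding has_vector_derivative_def by (metis scaleR_one)
qed

text \<open>On \<open>I\<close> the velocity is the Frechet derivative in the fixed direction 1, and
  smoothness depends only on values on \<open>I\<close>.\<close>

lemma smooth_on_derivative_in:
  assumes "unique_derivs I" "smooth_on I f"
  shows "smooth_on I (derivative_in I f)"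
  by (subst smooth_on_cong[OF derivative_in_eq_frechet[OF assms]])
     (simp_all add: smooth_on_frechet_derivative assms(2))

text \<open>Agreement of \<open>h\<close> with the component is asked for on \<open>I\<close> only,
  since the coordinate functions of the curve and their derivatives are tied to the curve only
  there.\<close>

lemma derivative_in_vec_nth:
  fixes f :: "real \<Rightarrow> real ^ 'n"
  assumes "unique_derivs I" "smooth_on I f" "s \<in> I" "\<And>r. r \<in> I \<Longrightarrow> h r = f r $ i"
  shows "derivative_in I h s = derivative_in I f s $ i"
proof (rule derivative_in_eq[OF assms(1,3)])
  have "((\<lambda>r. f r $ i) has_vector_derivative derivative_in I f s $ i) (at s within I)"
    using bounded_linear.has_vector_derivative[OF bounded_linear_vec_nth has_vector_derivative_in[OF assms(2,3)]] .
  then show "(h has_vector_derivative derivative_in I f s $ i) (at s within I)"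
    by (rule has_vector_derivative_transform[OF assms(3), rotated]) (simp add: assms(4))
qed

section \<open>The Levi-Civita connection\<close>

text \<open>With \<Gamma> indexed by coordinates, the nonzero symbols up to symmetry are
  \<open>Gamma^1_13 = -m\<close>, \<open>Gamma^2_23 = n\<close>,
  \<open>Gamma^3_11 = m exp(-2mt)\<close> and \<open>Gamma^3_22 = -n exp(2nt)\<close>. The last
  component is written as a sum with factor \<open>- n\<close> so that closure under sums and
  products gives its smoothness.\<close>

definition sol_christoffel :: "real \<Rightarrow> real \<Rightarrow> real ^ 3 \<Rightarrow> real ^ 3 \<Rightarrow> real ^ 3 \<Rightarrow> real ^ 3" where
  "sol_christoffel m n p u v = vector
     [- m * (u $ 1 * v $ 3 + u $ 3 * v $ 1),
      n * (u $ 2 * v $ 3 + u $ 3 * v $ 2),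
      m * exp (- 2 * m * p $ 3) * u $ 1 * v $ 1 + - n * exp (2 * n * p $ 3) * u $ 2 * v $ 2]"

lemma sol_christoffel_nth [simp]:
  "sol_christoffel m n p u v $ 1 = - m * (u $ 1 * v $ 3 + u $ 3 * v $ 1)"
  "sol_christoffel m n p u v $ 2 = n * (u $ 2 * v $ 3 + u $ 3 * v $ 2)"
  "sol_christoffel m n p u v $ 3 =
     m * exp (- 2 * m * p $ 3) * u $ 1 * v $ 1 - n * exp (2 * n * p $ 3) * u $ 2 * v $ 2"
  by (simp_all add: sol_christoffel_def)

lemma sol_christoffel_commute: "sol_christoffel m n p u v = sol_christoffel m n p v u"
  by (simp add: vec_eq_iff forall_3 algebra_simps)

lemma sol_christoffel_lincomb_right:
  "sol_christoffel m n p u (a *\<^sub>R v + b *\<^sub>R w) =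
    a *\<^sub>R sol_christoffel m n p u v + b *\<^sub>R sol_christoffel m n p u w"
  by (simp add: vec_eq_iff forall_3 algebra_simps)

lemma sol_christoffel_scaleR_right:
  "sol_christoffel m n p u (a *\<^sub>R v) = a *\<^sub>R sol_christoffel m n p u v"
  using sol_christoffel_lincomb_right[of m n p u a v 0 v] by simp

lemma sol_christoffel_lincomb_left:
  "sol_christoffel m n p (a *\<^sub>R v + b *\<^sub>R w) u =
    a *\<^sub>R sol_christoffel m n p v u + b *\<^sub>R sol_christoffel m n p w u"
  by (simp only: sol_christoffel_commute[of m n p _ u] sol_christoffel_lincomb_right)

lemma smooth_on_sol_christoffel:
  fixes q u v :: "'a::euclidean_space \<Rightarrow> real ^ 3"
  assumes S: "unique_derivs S" and "smooth_on S q" "smooth_on S u" "smooth_on S v"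
  shows "smooth_on S (\<lambda>s. sol_christoffel m n (q s) (u s) (v s))"
  unfolding sol_christoffel_def using assms
  by (intro smooth_on_vector_3[OF S] smooth_on_add[OF S] smooth_on_mult[OF S] smooth_on_exp[OF S]
      smooth_on_const[OF S] smooth_on_vec_nth[OF S])

section \<open>Existence of the Levi-Civita connection\<close>

definition sol_connection ::
  "real \<Rightarrow> real \<Rightarrow> (real ^ 3) vfield \<Rightarrow> (real ^ 3) vfield \<Rightarrow> (real ^ 3) vfield" where
  "sol_connection m n X Y = (\<lambda>p. dir_deriv X Y p + sol_christoffel m n p (X p) (Y p))"

text \<open>The directional derivative accounts for the Leibniz term; the Christoffel term is
  pointwise bilinear and so respects multiplication by functions in both arguments.\<close>

lemma affine_connection_sol: "affine_connection (sol_connection m n)"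
  unfolding affine_connection_def
proof (intro conjI allI impI)
  fix X Y :: "(real ^ 3) vfield"
  assume XY: "smooth_on UNIV X" "smooth_on UNIV Y"
  show "smooth_on UNIV (sol_connection m n X Y)"
    unfolding sol_connection_def
    by (intro smooth_on_add smooth_on_dir_deriv smooth_on_sol_christoffel smooth_on_ident
        unique_derivs_UNIV XY)
next
  fix f h :: "real ^ 3 \<Rightarrow> real" and X Z Y :: "(real ^ 3) vfield"
  assume Y: "smooth_on UNIV Y"
  have "dir_deriv (\<lambda>p. f p *\<^sub>R X p + h p *\<^sub>R Z p) Y p =
      f p *\<^sub>R dir_deriv X Y p + h p *\<^sub>R dir_deriv Z Y p" for p
  proof -
    interpret linear "frechet_derivative Y (at p)"
      using smooth_on_has_derivative[OF Y] has_derivative_linear by blast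
    show ?thesis by (simp add: dir_deriv_def add scaleR)
  qed
  then show "sol_connection m n (\<lambda>p. f p *\<^sub>R X p + h p *\<^sub>R Z p) Y =
      (\<lambda>p. f p *\<^sub>R sol_connection m n X Y p + h p *\<^sub>R sol_connection m n Z Y p)"
    by (simp add: sol_connection_def sol_christoffel_lincomb_left scaleR_add_right fun_eq_iff)
next
  fix a b :: real and X Y Z :: "(real ^ 3) vfield"
  assume Y: "smooth_on UNIV Y" and Z: "smooth_on UNIV Z"
  have "dir_deriv X (\<lambda>p. a *\<^sub>R Y p + b *\<^sub>R Z p) p =
      a *\<^sub>R dir_deriv X Y p + b *\<^sub>R dir_deriv X Z p" for p
    using dir_deriv_eq[OF has_derivative_add[OF has_derivative_scaleR_right[OF smooth_on_has_derivative[OF Y]]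
        has_derivative_scaleR_right[OF smooth_on_has_derivative[OF Z]]]]
    by (simp add: dir_deriv_def)
  then show "sol_connection m n X (\<lambda>p. a *\<^sub>R Y p + b *\<^sub>R Z p) =
      (\<lambda>p. a *\<^sub>R sol_connection m n X Y p + b *\<^sub>R sol_connection m n X Z p)"
    by (simp add: sol_connection_def sol_christoffel_lincomb_right scaleR_add_right fun_eq_iff)
next
  fix f :: "real ^ 3 \<Rightarrow> real" and X Y :: "(real ^ 3) vfield"
  assume f: "smooth_on UNIV f" and Y: "smooth_on UNIV Y"
  have "dir_deriv X (\<lambda>p. f p *\<^sub>R Y p) p = dir_deriv X f p *\<^sub>R Y p + f p *\<^sub>R dir_deriv X Y p" for p
    using dir_deriv_eq[OF has_derivative_scaleR[OF smooth_on_has_derivative[OF f]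
        smooth_on_has_derivative[OF Y]], of p X]
    by (simp add: dir_deriv_def add.commute)
  then show "sol_connection m n X (\<lambda>p. f p *\<^sub>R Y p) =
      (\<lambda>p. dir_deriv X f p *\<^sub>R Y p + f p *\<^sub>R sol_connection m n X Y p)"
    by (simp add: sol_connection_def sol_christoffel_scaleR_right scaleR_add_right fun_eq_iff)
qed

text \<open>The symmetric Christoffel terms cancel in the difference, which leaves the
  bracket.\<close>

lemma torsion_free_sol: "torsion_free (sol_connection m n)"
  unfolding torsion_free_def
proof (intro allI impI)
  fix X Y :: "(real ^ 3) vfield" and p
  show "sol_connection m n X Y p - sol_connection m n Y X p = lie_bracket X Y p"
    by (simp add: sol_connection_def lie_bracket_def sol_christoffel_commute[of m n p "X p"])
qed

text \<open>Product rule: two terms differentiate the fields, the other two the exponential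
  coefficients, which vary with the third coordinate alone.\<close>

lemma has_derivative_sol_metric:
  assumes X: "(X has_derivative X') (at p)" and Y: "(Y has_derivative Y') (at p)"
  shows "((\<lambda>q. sol_metric m n q (X q) (Y q)) has_derivative
    (\<lambda>v. sol_metric m n p (X' v) (Y p) + sol_metric m n p (X p) (Y' v)
       - 2 * m * v $ 3 * exp (- 2 * m * p $ 3) * X p $ 1 * Y p $ 1
       + 2 * n * v $ 3 * exp (2 * n * p $ 3) * X p $ 2 * Y p $ 2)) (at p)"
  unfolding sol_metric_def
  apply (rule derivative_eq_intros X Y bounded_linear.has_derivative[OF bounded_linear_vec_nth] refl)+
  apply (simp add: fun_eq_iff algebra_simps)
  done

text \<open>The Christoffel contributions add up to the derivatives of the exponential coefficients:
  mixed terms such as \<open>Z$1 * X$1 * Y$3\<close> from the first two components cancel against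
  those of the third.\<close>

lemma metric_compatible_sol: "metric_compatible (sol_metric m n) (sol_connection m n)"
  unfolding metric_compatible_def
proof (intro allI impI)
  fix X Y Z :: "(real ^ 3) vfield" and p
  assume X: "smooth_on UNIV X" and Y: "smooth_on UNIV Y"
  show "dir_deriv Z (\<lambda>q. sol_metric m n q (X q) (Y q)) p =
      sol_metric m n p (sol_connection m n Z X p) (Y p) +
      sol_metric m n p (X p) (sol_connection m n Z Y p)"
    unfolding dir_deriv_eq[OF has_derivative_sol_metric[OF smooth_on_has_derivative[OF X UNIV_I]
        smooth_on_has_derivative[OF Y UNIV_I]]]
    by (simp add: sol_metric_def sol_connection_def dir_deriv_def algebra_simps)
qed

lemma levi_civita_sol: "levi_civita (sol_metric m n) (sol_connection m n)"
  by (simp add: levi_civita_def affine_connection_sol torsion_free_sol metric_compatible_sol)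

text \<open>Constant fields have zero bracket, so torsion-freeness makes \<open>nabla\<close>
  symmetric on them. Koszul's formula then expresses it through derivatives of the metric
  coefficients, and nondegeneracy of the metric determines its value.\<close>

lemma levi_civita_const_fields:
  assumes "levi_civita (sol_metric m n) nabla"
  shows "nabla (\<lambda>_. u) (\<lambda>_. v) p = sol_christoffel m n p u v"
proof -
  let ?g = "sol_metric m n p"
  let ?N = "\<lambda>u v. nabla (\<lambda>_. u) (\<lambda>_. v) p"
  have smooth: "smooth_on UNIV (\<lambda>_::real^3. c)" for c :: "real ^ 3"
    by (rule smooth_on_const[OF unique_derivs_UNIV])
  have sym: "?N a b = ?N b a" for a b
  proof -
    have "?N a b - ?N b a = lie_bracket (\<lambda>_. a) (\<lambda>_. b) p"
      using assms smooth unfolding levi_civita_def torsion_free_def by blast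
    then show ?thesis by (simp add: lie_bracket_def dir_deriv_def)
  qed
  have compat: "?g (?N w a) b + ?g a (?N w b) =
      - 2 * m * w $ 3 * exp (- 2 * m * p $ 3) * a $ 1 * b $ 1
      + 2 * n * w $ 3 * exp (2 * n * p $ 3) * a $ 2 * b $ 2" for w a b
  proof -
    have "?g (?N w a) b + ?g a (?N w b) = dir_deriv (\<lambda>_. w) (\<lambda>q. sol_metric m n q a b) p"
      using assms smooth unfolding levi_civita_def metric_compatible_def by simp
    also have "\<dots> = - 2 * m * w $ 3 * exp (- 2 * m * p $ 3) * a $ 1 * b $ 1
      + 2 * n * w $ 3 * exp (2 * n * p $ 3) * a $ 2 * b $ 2"
      unfolding dir_deriv_eq[OF has_derivative_sol_metric[OF has_derivative_const has_derivative_const]]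
      by (simp add: sol_metric_def)
    finally show ?thesis .
  qed
  have g_commute: "?g a b = ?g b a" for a b by (simp add: sol_metric_def)
  have koszul: "?g (?N u v) w = ?g (sol_christoffel m n p u v) w" for w
  proof -
    \<comment> \<open>Compatibility for differentiation along \<open>u\<close> and along
      \<open>v\<close>, minus that along \<open>w\<close>; by symmetry everything except twice
      \<open>?g (?N u v) w\<close> cancels.\<close>
    have "2 * ?g (?N u v) w =
        (?g (?N u v) w + ?g v (?N u w)) + (?g (?N v u) w + ?g u (?N v w))
        - (?g (?N w u) v + ?g u (?N w v))"
      by (simp add: sym[of v u] sym[of w u] sym[of w v] g_commute[of v])
    also have "\<dots> = 2 * ?g (sol_christoffel m n p u v) w"
      unfolding compat by (simp add: sol_metric_def algebra_simps)
    finally show ?thesis by simp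
  qed
  show ?thesis
    \<comment> \<open>The metric is diagonal with positive entries, so testing against the three
      basis vectors reads off the components. Keeping the Christoffel components folded lets the
      exponential factors cancel.\<close>
    using koszul[of "axis 1 1"] koszul[of "axis 2 1"] koszul[of "axis 3 1"]
    by (auto simp: sol_metric_def axis_def vec_eq_iff forall_3 simp del: sol_christoffel_nth)
qed

section \<open>Covariant derivatives along the curve\<close>

text \<open>Expand \<open>V\<close> in the constant coordinate frame. The extension axiom fixes
  \<open>D\<close> on the frame fields, the Leibniz rule on their multiples by the components of
  \<open>V\<close>, and linearity on the sum.\<close>

lemma covariant_derivative_along_sol_eq:
  assumes I: "unique_derivs I" and lc: "levi_civita (sol_metric m n) nabla"
    and D: "covariant_derivative_along nabla I \<gamma> D"
    and V: "smooth_on I V" and s: "s \<in> I"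
  shows "D V s = derivative_in I V s + sol_christoffel m n (\<gamma> s) (derivative_in I \<gamma> s) (V s)"
proof -
  let ?u = "derivative_in I \<gamma> s"
  note smooth = smooth_on_const[OF I] smooth_on_vec_nth[OF I V]
  define E where "E i = (\<lambda>r. V r $ i *\<^sub>R (axis i 1 :: real ^ 3))" for i
  have smooth_E: "smooth_on I (E i)" for i
    unfolding E_def by (intro smooth_on_scaleR[OF I] smooth)
  have D_lincomb: "D (\<lambda>r. a *\<^sub>R F r + b *\<^sub>R G r) s = a *\<^sub>R D F s + b *\<^sub>R D G s"
    if "smooth_on I F" "smooth_on I G" for a b F G
    using D that s unfolding covariant_derivative_along_def by blast
  have D_const: "D (\<lambda>_. c) s = sol_christoffel m n (\<gamma> s) ?u c" for c
  proof -
    \<comment> \<open>A constant field along the curve is the restriction of a constant ambient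
      field, and the constant field \<open>?u\<close> extends the velocity at
      \<open>s\<close>.\<close>
    have "D (\<lambda>r. (\<lambda>_. c) (\<gamma> r)) s = nabla (\<lambda>_. ?u) (\<lambda>_. c) (\<gamma> s)"
      using D s smooth_on_const[OF unique_derivs_UNIV]
      unfolding covariant_derivative_along_def by blast
    then show ?thesis by (simp add: levi_civita_const_fields[OF lc])
  qed
  have D_E: "D (E i) s = derivative_in I V s $ i *\<^sub>R axis i 1
      + sol_christoffel m n (\<gamma> s) ?u (E i s)" for i
  proof -
    have "D (E i) s = derivative_in I (\<lambda>r. V r $ i) s *\<^sub>R axis i 1 + V s $ i *\<^sub>R D (\<lambda>_. axis i 1) s"
      using D s smooth unfolding covariant_derivative_along_def E_def by blast
    also have "derivative_in I (\<lambda>r. V r $ i) s = derivative_in I V s $ i"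
      by (rule derivative_in_vec_nth[OF I V s]) simp
    finally show ?thesis by (simp add: D_const E_def sol_christoffel_scaleR_right)
  qed
  \<comment> \<open>\<open>D\<close> acts on whole functions, so this equality is proved on all of
    the reals. The factors 1 give the sum the shape of the linearity axiom, which is applied
    twice.\<close>
  have V_eq: "V = (\<lambda>r. 1 *\<^sub>R E 1 r + 1 *\<^sub>R (1 *\<^sub>R E 2 r + 1 *\<^sub>R E 3 r))"
    by (simp add: fun_eq_iff E_def vec_eq_iff forall_3 axis_def)
  have "D V s = D (\<lambda>r. 1 *\<^sub>R E 1 r + 1 *\<^sub>R (1 *\<^sub>R E 2 r + 1 *\<^sub>R E 3 r)) s"
    using V_eq by simp
  also have "\<dots> = 1 *\<^sub>R D (E 1) s + 1 *\<^sub>R (1 *\<^sub>R D (E 2) s + 1 *\<^sub>R D (E 3) s)"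
    by (subst D_lincomb; (subst D_lincomb)?)
       (simp_all add: smooth_E smooth_on_add[OF I])
  also have "\<dots> = derivative_in I V s + sol_christoffel m n (\<gamma> s) ?u (V s)"
    unfolding D_E by (simp add: E_def vec_eq_iff forall_3 axis_def algebra_simps)
  finally show ?thesis .
qed

text \<open>Linearity and the Leibniz rule come from ordinary differentiation, the Christoffel term
  being linear in \<open>V\<close>. The extension axiom is the chain rule for an ambient field along
  \<gamma>.\<close>

lemma covariant_derivative_along_sol:
  assumes I: "unique_derivs I" and \<gamma>: "smooth_on I \<gamma>"
  shows "covariant_derivative_along (sol_connection m n) I \<gamma>
    (\<lambda>V s. derivative_in I V s + sol_christoffel m n (\<gamma> s) (derivative_in I \<gamma> s) (V s))"
  unfolding covariant_derivative_along_def
proof (intro conjI allI impI ballI)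
  fix V :: "real \<Rightarrow> real ^ 3" assume "smooth_on I V"
  then show "smooth_on I
      (\<lambda>s. derivative_in I V s + sol_christoffel m n (\<gamma> s) (derivative_in I \<gamma> s) (V s))"
    by (intro smooth_on_add[OF I] smooth_on_sol_christoffel[OF I] smooth_on_derivative_in[OF I] \<gamma>)
next
  fix a b s and V W :: "real \<Rightarrow> real ^ 3"
  assume VW: "smooth_on I V" "smooth_on I W" and s: "s \<in> I"
  have "derivative_in I (\<lambda>r. a *\<^sub>R V r + b *\<^sub>R W r) s =
      a *\<^sub>R derivative_in I V s + b *\<^sub>R derivative_in I W s"
    by (rule derivative_in_eq[OF I s])
       (rule derivative_eq_intros has_vector_derivative_in VW s refl
          bounded_linear.has_vector_derivative[OF bounded_linear_scaleR_right])+
  then show "derivative_in I (\<lambda>r. a *\<^sub>R V r + b *\<^sub>R W r) s +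
      sol_christoffel m n (\<gamma> s) (derivative_in I \<gamma> s) (a *\<^sub>R V s + b *\<^sub>R W s) =
      a *\<^sub>R (derivative_in I V s + sol_christoffel m n (\<gamma> s) (derivative_in I \<gamma> s) (V s)) +
      b *\<^sub>R (derivative_in I W s + sol_christoffel m n (\<gamma> s) (derivative_in I \<gamma> s) (W s))"
    by (simp add: sol_christoffel_lincomb_right scaleR_add_right)
next
  fix f :: "real \<Rightarrow> real" and V :: "real \<Rightarrow> real ^ 3" and s
  assume f: "smooth_on I f" and V: "smooth_on I V" and s: "s \<in> I"
  have "derivative_in I (\<lambda>r. f r *\<^sub>R V r) s =
      f s *\<^sub>R derivative_in I V s + derivative_in I f s *\<^sub>R V s"
    using bounded_bilinear.has_vector_derivative[OF bounded_bilinear_scaleR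
        has_vector_derivative_in[OF f s] has_vector_derivative_in[OF V s]]
    by (rule derivative_in_eq[OF I s])
  then show "derivative_in I (\<lambda>r. f r *\<^sub>R V r) s +
      sol_christoffel m n (\<gamma> s) (derivative_in I \<gamma> s) (f s *\<^sub>R V s) =
      derivative_in I f s *\<^sub>R V s +
      f s *\<^sub>R (derivative_in I V s + sol_christoffel m n (\<gamma> s) (derivative_in I \<gamma> s) (V s))"
    by (simp add: sol_christoffel_scaleR_right scaleR_add_right)
next
  fix X W :: "(real ^ 3) vfield" and s
  assume X: "smooth_on UNIV X" and s: "s \<in> I" and W: "W (\<gamma> s) = derivative_in I \<gamma> s"
  have "((\<lambda>r. X (\<gamma> r)) has_derivative
      (\<lambda>h. frechet_derivative X (at (\<gamma> s)) (h *\<^sub>R derivative_in I \<gamma> s))) (at s within I)"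
    using has_derivative_compose[OF has_vector_derivative_in[OF \<gamma> s, unfolded has_vector_derivative_def]
        smooth_on_has_derivative[OF X UNIV_I]] by simp
  moreover have "frechet_derivative X (at (\<gamma> s)) (h *\<^sub>R derivative_in I \<gamma> s) =
      h *\<^sub>R frechet_derivative X (at (\<gamma> s)) (derivative_in I \<gamma> s)" for h
    using smooth_on_has_derivative[OF X UNIV_I] has_derivative_linear linear_scale by blast
  ultimately have "((\<lambda>r. X (\<gamma> r)) has_vector_derivative
      frechet_derivative X (at (\<gamma> s)) (derivative_in I \<gamma> s)) (at s within I)"
    unfolding has_vector_derivative_def by simp
  \<comment> \<open>The directional derivative uses only the value of \<open>W\<close> at
    \<open>\<gamma> s\<close>, which is the velocity.\<close>
  then have "derivative_in I (\<lambda>r. X (\<gamma> r)) s = dir_deriv W X (\<gamma> s)"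
    using derivative_in_eq[OF I s] W by (simp add: dir_deriv_def)
  then show "derivative_in I (\<lambda>r. X (\<gamma> r)) s +
      sol_christoffel m n (\<gamma> s) (derivative_in I \<gamma> s) (X (\<gamma> s)) = sol_connection m n W X (\<gamma> s)"
    by (simp add: sol_connection_def W)
qed

text \<open>\<open>geodesic_on\<close> asks for some \<open>nabla\<close> and \<open>D\<close>.
  Uniqueness turns any such pair into the explicit equation, and the explicit pair serves as the
  witness for the converse.\<close>

lemma geodesic_on_sol_iff:
  assumes I: "unique_derivs I" and \<gamma>: "smooth_on I \<gamma>"
  shows "geodesic_on (sol_metric m n) I \<gamma> \<longleftrightarrow>
    (\<forall>s\<in>I. derivative_in I (derivative_in I \<gamma>) s +
      sol_christoffel m n (\<gamma> s) (derivative_in I \<gamma> s) (derivative_in I \<gamma> s) = 0)"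
  (is "_ \<longleftrightarrow> ?geod")
proof
  assume "geodesic_on (sol_metric m n) I \<gamma>"
  then show ?geod
    unfolding geodesic_on_def
    using covariant_derivative_along_sol_eq[OF I _ _ smooth_on_derivative_in[OF I \<gamma>]] by metis
next
  assume ?geod
  then show "geodesic_on (sol_metric m n) I \<gamma>"
    unfolding geodesic_on_def
    using levi_civita_sol covariant_derivative_along_sol[OF I \<gamma>] by blast
qed

theorem theorem6:
  fixes m n :: real and I :: "real set"
    and \<gamma> :: "real \<Rightarrow> real ^ 3" and x y t :: "real \<Rightarrow> real"
  assumes "m > 0" and "n > 0"
    and "is_interval I" and "\<And>a. I \<noteq> {a}"
    and "smooth_on I \<gamma>"
    and "\<And>s. s \<in> I \<Longrightarrow> \<gamma> s = vector [x s, y s, t s]"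
  shows "geodesic_on (sol_metric m n) I \<gamma> \<longleftrightarrow>
    (\<forall>s\<in>I.
      derivative_in I (derivative_in I x) s
        - 2 * m * derivative_in I t s * derivative_in I x s = 0 \<and>
      derivative_in I (derivative_in I y) s
        + 2 * n * derivative_in I t s * derivative_in I y s = 0 \<and>
      derivative_in I (derivative_in I t) s
        + m * exp (- 2 * m * t s) * (derivative_in I x s)\<^sup>2
        - n * exp (2 * n * t s) * (derivative_in I y s)\<^sup>2 = 0)"
proof -
  have I: "unique_derivs I"
    by (rule unique_derivs_interval[OF assms(3,4)])
  note \<gamma> = assms(5)
  have coords: "\<gamma> s $ 1 = x s" "\<gamma> s $ 2 = y s" "\<gamma> s $ 3 = t s" if "s \<in> I" for s
    using assms(6)[OF that] by simp_all
  have first: "derivative_in I x s = derivative_in I \<gamma> s $ 1"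
    "derivative_in I y s = derivative_in I \<gamma> s $ 2"
    "derivative_in I t s = derivative_in I \<gamma> s $ 3" if "s \<in> I" for s
    by (rule derivative_in_vec_nth[OF I \<gamma> that]; simp add: coords)+
  \<comment> \<open>The same component rule is applied to the velocity; by \<open>first\<close>, the
    scalar derivatives agree with its components on \<open>I\<close>.\<close>
  have second: "derivative_in I (derivative_in I x) s = derivative_in I (derivative_in I \<gamma>) s $ 1"
    "derivative_in I (derivative_in I y) s = derivative_in I (derivative_in I \<gamma>) s $ 2"
    "derivative_in I (derivative_in I t) s = derivative_in I (derivative_in I \<gamma>) s $ 3"
    if "s \<in> I" for s
    by (rule derivative_in_vec_nth[OF I smooth_on_derivative_in[OF I \<gamma>] that]; simp add: first)+
  show ?thesis
    \<comment> \<open>With both arguments equal to the velocity, the two mixed Christoffel terms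
      coincide, which produces the factors 2 in the first two equations.\<close>
    unfolding geodesic_on_sol_iff[OF I \<gamma>]
    by (rule ball_cong)
       (simp_all add: vec_eq_iff forall_3 first second coords algebra_simps power2_eq_square)
qed

end
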